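(* There is a randomized algorithm in the CongestedClique model which, on a connected, simple, undirected graph $G=(V,E)$ with $n$ vertices and a given integer $\tau\ge 1$, ends with every vertex $v$ holding a walk of length $\tau'$ starting at $v$, where $\tau\le\tau'=O(\tau)$ ($\tau'$ the smallest power of $2$ that is at least $\tau$), such that each such walk is distributed as a simple random walk of length $\tau'$ on $G$ started at $v$ (walks held by different vertices need not be independent). With high probability (probability at least $1-n^{-c}$ for any desired constant $c>0$, the constants in the bounds depending on $c$), the algorithm runs in (i) $O\!\left(\frac{\tau}{n}\log\tau\log n\right)$ rounds if $\tau=\Omega(n/\log n)$, and (ii) $O(\log \tau)$ rounds if $\tau = O(n/\log n)$.
   Context: The CongestedClique model: the input is an $n$-vertex graph $G=(V,E)$ whose vertices are identified with $n$ machines with IDs $1,\dots,n$; machine $i$ initially knows vertex $i$, all edges of $G$ incident to $i$, and $n$. Computation proceeds in synchronous rounds; in each round every machine performs arbitrary local computation (using private randomness) and then sends a possibly different message of $O(\log n)$ bits to every other machine. The complexity of an algorithm is its number of rounds. A simple random walk on $G$ moves from a vertex $u$ to a uniformly random neighbor of $u$ at each step. *)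

theory Defs
  imports "HOL-Probability.Probability"
begin

section \<open>Graphs\<close>

text \<open>Vertices (= machines) are 0,...,n-1 (the paper's IDs 1..n shifted by one).
  A simple undirected graph is a symmetric irreflexive edge relation on {0..<n}.\<close>

definition simple_graph :: "nat \<Rightarrow> (nat \<Rightarrow> nat \<Rightarrow> bool) \<Rightarrow> bool" where
  "simple_graph n E \<longleftrightarrow>
     (\<forall>u v. E u v \<longrightarrow> u < n \<and> v < n) \<and> (\<forall>u v. E u v \<longrightarrow> E v u) \<and> (\<forall>u. \<not> E u u)"

definition connected_graph :: "nat \<Rightarrow> (nat \<Rightarrow> nat \<Rightarrow> bool) \<Rightarrow> bool" where
  "connected_graph n E \<longleftrightarrow>
     (\<forall>u v. u < n \<and> v < n \<longrightarrow> (u, v) \<in> {(x, y). E x y}\<^sup>*)"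

definition nbrs :: "(nat \<Rightarrow> nat \<Rightarrow> bool) \<Rightarrow> nat \<Rightarrow> nat set" where
  "nbrs E v = {u. E v u}"

section \<open>Simple random walk\<close>

text \<open>A walk of length k is the list of its k+1 vertices [v0, v1, ..., vk].\<close>

fun srw_pmf :: "(nat \<Rightarrow> nat \<Rightarrow> bool) \<Rightarrow> nat \<Rightarrow> nat \<Rightarrow> nat list pmf" where
  "srw_pmf E v 0 = return_pmf [v]"
| "srw_pmf E v (Suc k) =
     srw_pmf E v k \<bind> (\<lambda>w. map_pmf (\<lambda>u. w @ [u]) (pmf_of_set (nbrs E (last w))))"

text \<open>Smallest power of 2 that is at least tau.\<close>
definition pow2_ceil :: "nat \<Rightarrow> nat" where
  "pow2_ceil tau = 2 ^ (LEAST k. tau \<le> 2 ^ k)"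

section \<open>The CongestedClique model\<close>

text \<open>Private randomness: machine v reads the infinite fair-coin sequence
  (\<lambda>i. \<omega> (v, i)); all coins are independent.\<close>

definition coin_space :: "(nat \<times> nat \<Rightarrow> bool) measure" where
  "coin_space = PiM UNIV (\<lambda>_. measure_pmf (bernoulli_pmf (1/2)))"

text \<open>An algorithm is given by a message function and an output function.
  Both get: n, tau, own ID v, own neighbour set, own random coins, the current
  round t, and the machine's view = all messages received so far
  (view s u = message received from u in round s, for s < t).
  The message function additionally gets the recipient and returns a bit string;
  the output function returns None (not yet finished) or Some walk.
  Since the view determines everything the machine ever knew, this captures
  arbitrary local computation with arbitrary local memory.\<close>

type_synonym msg_fn =
  "nat \<Rightarrow> nat \<Rightarrow> nat \<Rightarrow> nat set \<Rightarrow> (nat \<Rightarrow> bool) \<Rightarrow> nat \<Rightarrow> (nat \<Rightarrow> nat \<Rightarrow> bool list) \<Rightarrow> nat \<Rightarrow> bool list"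
type_synonym out_fn =
  "nat \<Rightarrow> nat \<Rightarrow> nat \<Rightarrow> nat set \<Rightarrow> (nat \<Rightarrow> bool) \<Rightarrow> nat \<Rightarrow> (nat \<Rightarrow> nat \<Rightarrow> bool list) \<Rightarrow> nat list option"

text \<open>cc_hist ... t s u w = message sent from u to w in round s (for s < t).\<close>
fun cc_hist :: "msg_fn \<Rightarrow> nat \<Rightarrow> nat \<Rightarrow> (nat \<Rightarrow> nat \<Rightarrow> bool) \<Rightarrow> (nat \<times> nat \<Rightarrow> bool)
    \<Rightarrow> nat \<Rightarrow> nat \<Rightarrow> nat \<Rightarrow> nat \<Rightarrow> bool list" where
  "cc_hist msg n tau E \<omega> 0 = (\<lambda>s u w. [])"
| "cc_hist msg n tau E \<omega> (Suc t) =
     (\<lambda>s u w. if s < t then cc_hist msg n tau E \<omega> t s u w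
              else if s = t \<and> u < n \<and> w < n then
                msg n tau u (nbrs E u) (\<lambda>i. \<omega> (u, i)) t
                    (\<lambda>s' x. cc_hist msg n tau E \<omega> t s' x u) w
              else [])"

definition cc_view :: "msg_fn \<Rightarrow> nat \<Rightarrow> nat \<Rightarrow> (nat \<Rightarrow> nat \<Rightarrow> bool) \<Rightarrow> (nat \<times> nat \<Rightarrow> bool)
    \<Rightarrow> nat \<Rightarrow> nat \<Rightarrow> nat \<Rightarrow> nat \<Rightarrow> bool list" where
  "cc_view msg n tau E \<omega> t v = (\<lambda>s u. cc_hist msg n tau E \<omega> t s u v)"

text \<open>Output of machine v after t rounds of communication.\<close>
definition cc_output :: "msg_fn \<Rightarrow> out_fn \<Rightarrow> nat \<Rightarrow> nat \<Rightarrow> (nat \<Rightarrow> nat \<Rightarrow> bool) \<Rightarrow> (nat \<times> nat \<Rightarrow> bool)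
    \<Rightarrow> nat \<Rightarrow> nat \<Rightarrow> nat list option" where
  "cc_output msg out n tau E \<omega> t v =
     out n tau v (nbrs E v) (\<lambda>i. \<omega> (v, i)) t (cc_view msg n tau E \<omega> t v)"

definition cc_done :: "msg_fn \<Rightarrow> out_fn \<Rightarrow> nat \<Rightarrow> nat \<Rightarrow> (nat \<Rightarrow> nat \<Rightarrow> bool) \<Rightarrow> (nat \<times> nat \<Rightarrow> bool)
    \<Rightarrow> nat \<Rightarrow> bool" where
  "cc_done msg out n tau E \<omega> t \<longleftrightarrow> (\<forall>v<n. cc_output msg out n tau E \<omega> t v \<noteq> None)"

definition cc_terminates :: "msg_fn \<Rightarrow> out_fn \<Rightarrow> nat \<Rightarrow> nat \<Rightarrow> (nat \<Rightarrow> nat \<Rightarrow> bool) \<Rightarrow> (nat \<times> nat \<Rightarrow> bool)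
    \<Rightarrow> bool" where
  "cc_terminates msg out n tau E \<omega> \<longleftrightarrow> (\<exists>t. cc_done msg out n tau E \<omega> t)"

text \<open>Number of rounds: first round count after which every machine holds its output.\<close>
definition cc_rounds :: "msg_fn \<Rightarrow> out_fn \<Rightarrow> nat \<Rightarrow> nat \<Rightarrow> (nat \<Rightarrow> nat \<Rightarrow> bool) \<Rightarrow> (nat \<times> nat \<Rightarrow> bool)
    \<Rightarrow> nat" where
  "cc_rounds msg out n tau E \<omega> = (LEAST t. cc_done msg out n tau E \<omega> t)"

text \<open>The walk held by v at the end (default [] if the algorithm never ends).\<close>
definition cc_result :: "msg_fn \<Rightarrow> out_fn \<Rightarrow> nat \<Rightarrow> nat \<Rightarrow> (nat \<Rightarrow> nat \<Rightarrow> bool) \<Rightarrow> nat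
    \<Rightarrow> (nat \<times> nat \<Rightarrow> bool) \<Rightarrow> nat list" where
  "cc_result msg out n tau E v \<omega> =
     (if cc_terminates msg out n tau E \<omega>
      then the (cc_output msg out n tau E \<omega> (cc_rounds msg out n tau E \<omega>) v) else [])"

end

(* Every vertex u draws, for each time j, a random neighbour X(u,j); the walk from v follows
   w(j+1) = X(w(j),j). Sharing the X between all starting vertices makes the walks coalesce, but
   each single walk uses every time index only once and is therefore a simple random walk.
   Sharing also removes the congestion problem of the usual doubling algorithms: after the steps
   are fixed, what remains is to compose the maps X(-,0), X(-,1), ..., one per time step. Machine
   j mod n is in charge of time j, so each phase of parallel prefix doubling is a fixed
   communication pattern of two rounds per batch of n time steps. With T = 2^k the length of the
   walks, 2k(T div n + 1) rounds always suffice, with probability one. *)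

theory Submission
  imports Defs "HOL-Real_Asymp.Real_Asymp"
begin

section \<open>The algorithm and its execution\<close>

definition encode_bits :: "nat \<Rightarrow> nat \<Rightarrow> bool list" where
  "encode_bits b x = map (bit x) [0..<b]"

definition decode_bits :: "bool list \<Rightarrow> nat" where
  "decode_bits l = horner_sum of_bool 2 l"

lemma length_encode_bits [simp]: "length (encode_bits b x) = b"
  by (simp add: encode_bits_def)

lemma decode_encode_bits: "x < 2 ^ b \<Longrightarrow> decode_bits (encode_bits b x) = x"
  by (simp add: encode_bits_def decode_bits_def horner_sum_bit_eq_take_bit take_bit_nat_eq_self)

definition word_size :: "nat \<Rightarrow> nat" where
  "word_size n = nat \<lceil>log 2 (real n)\<rceil>"

lemma le_two_power_word_size: "1 \<le> n \<Longrightarrow> n \<le> 2 ^ word_size n"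
proof -
  assume n: "1 \<le> n"
  have "real n = 2 powr log 2 (real n)" using n by simp
  also have "\<dots> \<le> 2 powr real (word_size n)"
    unfolding word_size_def by (intro powr_mono) (auto intro: real_nat_ceiling_ge)
  also have "\<dots> = real (2 ^ word_size n)" by (simp add: powr_realpow)
  finally show ?thesis by (simp only: of_nat_le_iff)
qed

text \<open>Pointer doubling: \<open>jump X s x j\<close> is the position at time \<open>j + 1\<close> of the walker that follows \<open>X\<close>
  and stood at \<open>x\<close> at time \<open>max 0 (j + 1 - 2\<^sup>s)\<close>.\<close>

fun jump :: "(nat \<Rightarrow> nat \<Rightarrow> nat) \<Rightarrow> nat \<Rightarrow> nat \<Rightarrow> nat \<Rightarrow> nat" where
  "jump X 0 x j = X x j"
| "jump X (Suc s) x j =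
     (if 2 ^ s \<le> j then jump X s (jump X s x (j - 2 ^ s)) j else jump X s x j)"

fun travel :: "(nat \<Rightarrow> nat \<Rightarrow> nat) \<Rightarrow> nat \<Rightarrow> nat \<Rightarrow> nat \<Rightarrow> nat" where
  "travel X a 0 x = x"
| "travel X a (Suc k) x = X (travel X a k x) (a + k)"

lemma travel_add: "travel X a (k + l) x = travel X (a + k) l (travel X a k x)"
  by (induction l) (simp_all add: add.assoc)

text \<open>Doubling concatenates two windows of steps. The window ending at time
  \<open>j + 1\<close> has \<open>2 ^ s\<close> steps unless time 0 cuts it off; if
  \<open>j < 2 ^ s\<close>, it already reaches time 0, so the next phase must leave it
  unchanged.\<close>

lemma jump_eq_travel:
  "jump X s x j = travel X (Suc j - min (2 ^ s) (Suc j)) (min (2 ^ s) (Suc j)) x"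
proof (induction s arbitrary: x j)
  case 0
  then show ?case by simp
next
  case (Suc s)
  show ?case
  proof (cases "2 ^ s \<le> j")
    case True
    define i where "i = j - 2 ^ s"
    have j: "j = i + 2 ^ s" using True by (simp add: i_def)
    \<comment> \<open>The earlier window, ending at time \<open>Suc i\<close>, may itself be cut off
      at time 0; \<open>k\<close> is its true length.\<close>
    define k where "k = min (2 ^ s) (Suc i)"
    have k: "k \<le> Suc i" by (simp add: k_def)
    have "jump X (Suc s) x j = travel X (Suc i) (2 ^ s) (travel X (Suc i - k) k x)"
      using True by (simp add: Suc.IH i_def[symmetric] k_def[symmetric]) (simp add: j)
    also have "\<dots> = travel X (Suc i - k) (k + 2 ^ s) x"
      using k by (simp add: travel_add)
    also have "k + 2 ^ s = min (2 ^ Suc s) (Suc j)" by (simp add: k_def j)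
    also have "Suc i - k = Suc j - min (2 ^ Suc s) (Suc j)"
      by (simp add: k_def j min_def)
    finally show ?thesis .
  next
    case False
    then show ?thesis by (simp add: Suc.IH)
  qed
qed

lemma travel_less:
  assumes "\<And>u i. u < n \<Longrightarrow> X u i < n" "x < n"
  shows "travel X a k x < n"
  using assms by (induction k) auto

lemma jump_less:
  assumes "\<And>u i. u < n \<Longrightarrow> X u i < n" "x < n"
  shows "jump X s x j < n"
  unfolding jump_eq_travel by (rule travel_less[OF assms])

definition log_ceil :: "nat \<Rightarrow> nat" where
  "log_ceil tau = (LEAST k. tau \<le> 2 ^ k)"

text \<open>The \<open>+ 1\<close> covers an incomplete last batch and keeps the number positive, so
  that rounds can be split into phase and batch by dividing by it.\<close>

definition batches :: "nat \<Rightarrow> nat \<Rightarrow> nat" where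
  "batches n tau = pow2_ceil tau div n + 1"

text \<open>No state is stored: the column \<open>j \<mapsto> jump X s v j\<close> of machine \<open>v\<close> is read off the answers
  that \<open>v\<close> received in the odd rounds of phase \<open>s - 1\<close>. Time \<open>j\<close> is handled by machine
  \<open>j mod n\<close> in batch \<open>j div n\<close> of each phase.\<close>

definition column :: "nat \<Rightarrow> nat \<Rightarrow> (nat \<Rightarrow> nat) \<Rightarrow> (nat \<Rightarrow> nat \<Rightarrow> bool list)
    \<Rightarrow> nat \<Rightarrow> nat \<Rightarrow> nat" where
  "column n q X view s j = (if s = 0 then X j
     else decode_bits (view (2 * ((s - 1) * q + j div n) + 1) (j mod n)))"

text \<open>In round \<open>2 h\<close> machine \<open>v\<close> tells the machine in charge of time \<open>j\<close> where its pointers at \<open>j\<close> and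
  \<open>j - 2\<^sup>s\<close> lead (for \<open>j < 2\<^sup>s\<close> the second one is junk and is ignored). The machine in charge then
  knows the pointers at time \<open>j\<close> of all vertices, so it can compose them and answer.\<close>

definition walk_msg :: "(nat set \<Rightarrow> (nat \<Rightarrow> bool) \<Rightarrow> nat \<Rightarrow> nat) \<Rightarrow> msg_fn" where
  "walk_msg S n tau v A coins t view w =
    (let b = word_size n; q = batches n tau; h = t div 2; s = h div q; r = h mod q in
     if even t then
       let c = column n q (S A coins) view s; j = r * n + w
       in encode_bits b (c j) @ encode_bits b (c (j - 2 ^ s))
     else
       let here = (\<lambda>x. decode_bits (take b (view (t - 1) x)));
           back = (\<lambda>x. decode_bits (drop b (view (t - 1) x)))
       in encode_bits b (if 2 ^ s \<le> r * n + v then here (back w) else here w))"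

text \<open>The deadline is \<open>k\<close> phases of \<open>q\<close> batches with two rounds
  each. It depends on \<open>n\<close> and \<open>tau\<close> only, so all machines finish
  together.\<close>

definition walk_out :: "(nat set \<Rightarrow> (nat \<Rightarrow> bool) \<Rightarrow> nat \<Rightarrow> nat) \<Rightarrow> out_fn" where
  "walk_out S n tau v A coins t view =
    (let q = batches n tau; k = log_ceil tau in
     if 2 * k * q \<le> t
     then Some (v # map (column n q (S A coins) view k) [0..<pow2_ceil tau]) else None)"

text \<open>Recorded messages never change, so every lookup in a history reduces to the history
  taken right after round \<open>s\<close>; \<open>sent\<close> is this normal form.\<close>

lemma cc_hist_eq:
  "cc_hist msg n tau E \<omega> t s u w = (if s < t then cc_hist msg n tau E \<omega> (Suc s) s u w else [])"
proof (induction t)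
  case (Suc t)
  show ?case
  proof (cases "s < t")
    case True
    then have "cc_hist msg n tau E \<omega> (Suc t) s u w = cc_hist msg n tau E \<omega> t s u w" by simp
    with Suc True show ?thesis by (simp del: cc_hist.simps)
  qed (auto simp: less_Suc_eq)
qed simp

lemma walk_msg_even:
  "walk_msg S n tau v A coins (2 * h) view w =
    (let b = word_size n; q = batches n tau; c = column n q (S A coins) view (h div q);
         j = h mod q * n + w
     in encode_bits b (c j) @ encode_bits b (c (j - 2 ^ (h div q))))"
  by (simp add: walk_msg_def Let_def)

lemma walk_msg_odd:
  "walk_msg S n tau v A coins (2 * h + 1) view w =
    (let b = word_size n; q = batches n tau; m = view (2 * h)
     in encode_bits b
          (if 2 ^ (h div q) \<le> h mod q * n + v
           then decode_bits (take b (m (decode_bits (drop b (m w)))))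
           else decode_bits (take b (m w))))"
  by (simp add: walk_msg_def Let_def)

lemma length_walk_msg: "length (walk_msg S n tau v A coins t view w) \<le> 2 * word_size n"
  by (simp add: walk_msg_def Let_def)

text \<open>For fixed coins the run is deterministic, so it is analysed outcome by outcome. Of the
  sampler \<open>S\<close> it is only asked that it names vertices.\<close>

locale walk_run =
  fixes S :: "nat set \<Rightarrow> (nat \<Rightarrow> bool) \<Rightarrow> nat \<Rightarrow> nat" and n tau :: nat
    and E :: "nat \<Rightarrow> nat \<Rightarrow> bool" and \<omega> :: "nat \<times> nat \<Rightarrow> bool"
  assumes n_pos: "1 \<le> n"
    and S_less: "\<And>u j. u < n \<Longrightarrow> S (nbrs E u) (\<lambda>i. \<omega> (u, i)) j < n"
begin

definition step :: "nat \<Rightarrow> nat \<Rightarrow> nat" where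
  "step u j = S (nbrs E u) (\<lambda>i. \<omega> (u, i)) j"

abbreviation "q \<equiv> batches n tau"
abbreviation "b \<equiv> word_size n"
abbreviation "sent t u w \<equiv> cc_hist (walk_msg S) n tau E \<omega> (Suc t) t u w"
abbreviation "view t v \<equiv> cc_view (walk_msg S) n tau E \<omega> t v"

lemma q_pos: "0 < q" by (simp add: batches_def)

lemma view_eq: "s < t \<Longrightarrow> view t v s u = sent s u v"
  unfolding cc_view_def by (subst cc_hist_eq) simp

lemma sent_eq: "u < n \<Longrightarrow> w < n \<Longrightarrow>
    sent t u w = walk_msg S n tau u (nbrs E u) (\<lambda>i. \<omega> (u, i)) t (view t u) w"
  by (simp add: cc_view_def)

lemma decode_jump: "x < n \<Longrightarrow> decode_bits (encode_bits b (jump step s x j)) = jump step s x j"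
  by (intro decode_encode_bits order.strict_trans2[OF jump_less le_two_power_word_size])
     (use n_pos S_less in \<open>auto simp: step_def\<close>)

text \<open>Induction on the phase: all pointers at time \<open>j\<close> meet at machine
  \<open>j mod n\<close>, whose replies are the column of the next phase. The view time
  \<open>t\<close> is generalised because the hypothesis is used at round \<open>2 * h\<close>,
  before the final view.\<close>

lemma column_correct:
  assumes "x < n" "j < q * n" "2 * (s * q) \<le> t"
  shows "column n q (S (nbrs E x) (\<lambda>i. \<omega> (x, i))) (view t x) s j = jump step s x j"
  using assms
proof (induction s arbitrary: x j t)
  case 0
  then show ?case by (simp add: column_def step_def)
next
  case (Suc s)
  define r where "r = j div n"
  define w where "w = j mod n"
  define h where "h = s * q + r"
  have r: "r < q" using Suc.prems n_pos by (simp add: r_def less_mult_imp_div_less)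
  have w: "w < n" using n_pos by (simp add: w_def)
  have j: "j = r * n + w" by (simp add: r_def w_def)
  have hs: "h div q = s" "h mod q = r" using r q_pos by (simp_all add: h_def)
  \<comment> \<open>Truncated subtraction yields time 0 when \<open>j < 2 ^ s\<close>, so the second
    pointer is well defined even where it is ignored.\<close>
  have j': "j - 2 ^ s < q * n" using Suc.prems(2) by linarith
  have S1: "sent (2 * h) x w = encode_bits b (jump step s x j) @ encode_bits b (jump step s x (j - 2 ^ s))"
    if "x < n" for x
  proof -
    have "2 * (s * q) \<le> 2 * h" by (simp add: h_def)
    then show ?thesis
      unfolding sent_eq[OF that w]
      by (simp only: walk_msg_even Let_def hs j[symmetric] Suc.IH[OF that Suc.prems(2)]
          Suc.IH[OF that j'])
  qed
  have V: "view (2 * h + 1) w (2 * h) x = sent (2 * h) x w" for x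
    by (rule view_eq) simp
  \<comment> \<open>Machine \<open>w\<close> looks up the message of a vertex it has just decoded;
    this bound makes that vertex a genuine sender, so that \<open>S1\<close> applies to it.\<close>
  have lt: "jump step s x i < n" if "x < n" for x i
    using that S_less by (intro jump_less) (auto simp: step_def)
  have "sent (2 * h + 1) w x = encode_bits b (jump step (Suc s) x j)"
    unfolding sent_eq[OF w Suc.prems(1)] walk_msg_odd Let_def hs j[symmetric] V
    by (simp add: S1 decode_jump lt Suc.prems(1) del: cc_hist.simps)
  moreover have "2 * h + 1 < t"
  proof -
    have "h < Suc s * q" using r by (simp add: h_def)
    then show ?thesis using Suc.prems(3) by linarith
  qed
  ultimately show ?case
    using Suc.prems(1)
    by (simp only: column_def r_def[symmetric] w_def[symmetric] h_def[symmetric] diff_Suc_1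
        view_eq decode_jump) simp
qed

definition walk :: "nat \<Rightarrow> nat list" where
  "walk v = map (\<lambda>k. travel step 0 k v) [0..<Suc (pow2_ceil tau)]"

text \<open>After \<open>log_ceil tau\<close> phases the window length equals the walk length, so
  for each \<open>j\<close> below it the window reaches back to time 0.\<close>

lemma walk_eq: "v # map (jump step (log_ceil tau) v) [0..<pow2_ceil tau] = walk v"
proof -
  have "jump step (log_ceil tau) v j = travel step 0 (Suc j) v" if "j < pow2_ceil tau" for j
    using that unfolding jump_eq_travel
    by (simp add: pow2_ceil_def log_ceil_def min_absorb2 Suc_leI del: travel.simps)
  then show ?thesis
    unfolding walk_def by (simp add: upt_conv_Cons map_Suc_upt[symmetric] del: upt_Suc travel.simps(2))
qed

lemma output_eq:
  assumes "v < n"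
  shows "cc_output (walk_msg S) (walk_out S) n tau E \<omega> t v =
    (if 2 * log_ceil tau * q \<le> t then Some (walk v) else None)"
proof -
  have "pow2_ceil tau < q * n"
    using n_pos dividend_less_div_times[of n "pow2_ceil tau"] by (simp add: batches_def algebra_simps)
  then have "column n q (S (nbrs E v) (\<lambda>i. \<omega> (v, i))) (view t v) (log_ceil tau) j
      = jump step (log_ceil tau) v j" if "2 * log_ceil tau * q \<le> t" "j < pow2_ceil tau" for j
    using that assms by (intro column_correct) auto
  then show ?thesis
    unfolding cc_output_def walk_out_def Let_def walk_eq[symmetric] by auto
qed

lemma done_iff: "cc_done (walk_msg S) (walk_out S) n tau E \<omega> t \<longleftrightarrow> 2 * log_ceil tau * q \<le> t"
  using n_pos by (auto simp: cc_done_def output_eq)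

lemma terminates: "cc_terminates (walk_msg S) (walk_out S) n tau E \<omega>"
  by (auto simp: cc_terminates_def done_iff)

lemma rounds: "cc_rounds (walk_msg S) (walk_out S) n tau E \<omega> = 2 * log_ceil tau * q"
  unfolding cc_rounds_def done_iff by (rule Least_equality) auto

lemma result: "v < n \<Longrightarrow> cc_result (walk_msg S) (walk_out S) n tau E v \<omega> = walk v"
  by (simp add: cc_result_def terminates rounds output_eq)

end

section \<open>Uniform sampling from fair coins\<close>

text \<open>Rejection sampling: a block of coins encodes \<open>a\<close> if it shows heads exactly at position \<open>a\<close>, so
  that all elements of \<open>A\<close> have the same probability whatever the cardinality of \<open>A\<close>.\<close>

definition accepts :: "nat set \<Rightarrow> (nat \<Rightarrow> bool) \<Rightarrow> nat \<Rightarrow> nat \<Rightarrow> bool" where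
  "accepts A b j a \<longleftrightarrow> a \<in> A \<and> (\<forall>i\<le>Max A. b (prod_encode (j, i)) \<longleftrightarrow> i = a)"

definition trial :: "nat set \<Rightarrow> (nat \<Rightarrow> bool) \<Rightarrow> nat \<Rightarrow> nat option" where
  "trial A b j = (if \<exists>a. accepts A b j a then Some (THE a. accepts A b j a) else None)"

text \<open>The default \<open>Min A\<close> keeps the choice inside a finite nonempty
  \<open>A\<close> for all coin sequences, not just almost all; hence runs are correct and on time
  surely.\<close>

definition uniform_choice :: "nat set \<Rightarrow> (nat \<Rightarrow> bool) \<Rightarrow> nat" where
  "uniform_choice A b =
    (if \<exists>j. trial A b j \<noteq> None then the (trial A b (LEAST j. trial A b j \<noteq> None)) else Min A)"

lemma accepts_unique:
  assumes "finite A" "accepts A b j a" "accepts A b j a'"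
  shows "a = a'"
proof -
  have "a \<le> Max A" using assms by (auto simp: accepts_def)
  then show ?thesis using assms(2,3) unfolding accepts_def by metis
qed

lemma trial_eq_Some_iff: "finite A \<Longrightarrow> trial A b j = Some a \<longleftrightarrow> accepts A b j a"
  unfolding trial_def by (auto intro: theI dest: accepts_unique intro!: the_equality)

lemma trial_in: "finite A \<Longrightarrow> trial A b j = Some a \<Longrightarrow> a \<in> A"
  by (simp add: trial_eq_Some_iff accepts_def)

lemma uniform_choice_in:
  assumes "finite A" "A \<noteq> {}"
  shows "uniform_choice A b \<in> A"
proof (cases "\<exists>j. trial A b j \<noteq> None")
  case True
  then have "trial A b (LEAST j. trial A b j \<noteq> None) \<noteq> None" by (rule LeastI_ex)
  with True show ?thesis
    using trial_in[OF assms(1)] by (auto simp: uniform_choice_def)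
next
  case False
  then show ?thesis using assms by (simp add: uniform_choice_def)
qed

lemma uniform_choice_eqI:
  assumes "trial A b k = Some a" "\<And>j. j < k \<Longrightarrow> trial A b j = None"
  shows "uniform_choice A b = a"
proof -
  have "(LEAST j. trial A b j \<noteq> None) = k"
    by (rule Least_equality) (use assms in \<open>auto simp: not_less[symmetric]\<close>)
  then show ?thesis using assms(1) unfolding uniform_choice_def by auto
qed

abbreviation coin :: "bool measure" where
  "coin \<equiv> measure_pmf (bernoulli_pmf (1/2))"

lemma measurable_trial:
  assumes "finite A"
    and [measurable]: "\<And>i. (\<lambda>x. f x (prod_encode (j, i))) \<in> M \<rightarrow>\<^sub>M count_space UNIV"
  shows "(\<lambda>x. trial A (f x) j) \<in> M \<rightarrow>\<^sub>M count_space UNIV"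
proof -
  have S [measurable]: "Measurable.pred M (\<lambda>x. accepts A (f x) j a)" for a
    unfolding accepts_def by measurable
  have *: "trial A (f x) j = o' \<longleftrightarrow>
      (case o' of Some a \<Rightarrow> accepts A (f x) j a | None \<Rightarrow> \<forall>a. \<not> accepts A (f x) j a)" for x o'
    by (cases o') (simp add: trial_def, simp add: trial_eq_Some_iff[OF assms(1)])
  have "Measurable.pred M (\<lambda>x. trial A (f x) j = o')" for o'
    unfolding * by (cases o') simp_all
  then show ?thesis
    by (subst measurable_count_space_eq_countable) (auto simp: pred_def vimage_def Int_def conj_commute)
qed

lemma measurable_uniform_choice:
  assumes "finite A" and "\<And>i. (\<lambda>x. f x i) \<in> M \<rightarrow>\<^sub>M count_space UNIV"
  shows "(\<lambda>x. uniform_choice A (f x)) \<in> M \<rightarrow>\<^sub>M count_space UNIV"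
proof -
  have [measurable]: "(\<lambda>x. trial A (f x) j) \<in> M \<rightarrow>\<^sub>M count_space UNIV" for j
    by (intro measurable_trial assms)
  have [measurable]: "(\<lambda>x. trial A (f x) (LEAST j. trial A (f x) j \<noteq> None)) \<in> M \<rightarrow>\<^sub>M count_space UNIV" (is "?t \<in> _")
    by (rule measurable_compose_countable[where f = "\<lambda>j x. trial A (f x) j"]) measurable
  have [measurable]: "(\<lambda>x. the (trial A (f x) (LEAST j. trial A (f x) j \<noteq> None)))
      \<in> M \<rightarrow>\<^sub>M count_space UNIV"
    by (rule measurable_compose[where f = ?t and N = "count_space UNIV"]) simp_all
  show ?thesis unfolding uniform_choice_def by measurable
qed

text \<open>Grouping principle behind the independence claims below: for the trials of one choice,
  for the choices at different sites, and for the coins read by one site.\<close>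

lemma (in prob_space) indep_vars_disjoint_functions:
  assumes "indep_vars (\<lambda>_. N) Z UNIV"
    and "\<And>k. k \<in> L \<Longrightarrow> F k \<in> PiM (K k) (\<lambda>_. N) \<rightarrow>\<^sub>M R"
    and "disjoint_family_on K L"
  shows "indep_vars (\<lambda>_. R) (\<lambda>k x. F k (restrict (\<lambda>i. Z i x) (K k))) L"
  using indep_vars_compose2[OF indep_vars_restrict[OF assms(1) _ assms(3)] assms(2)] by simp

lemma (in prob_space) indep_vars_trial:
  assumes "finite A" "indep_vars (\<lambda>_. coin) b UNIV"
  shows "indep_vars (\<lambda>_. count_space UNIV) (\<lambda>j x. trial A (\<lambda>i. b i x) j) UNIV"
proof -
  define K where "K j = range (\<lambda>i. prod_encode (j, i))" for j :: nat
  have "indep_vars (\<lambda>_. count_space UNIV) (\<lambda>j x. trial A (restrict (\<lambda>i. b i x) (K j)) j) UNIV"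
  proof (rule indep_vars_disjoint_functions[OF assms(2), where F = "\<lambda>j g. trial A g j"])
    show "(\<lambda>g. trial A g j) \<in> PiM (K j) (\<lambda>_. coin) \<rightarrow>\<^sub>M count_space UNIV" for j
    proof (rule measurable_trial[OF assms(1)])
      have "(\<lambda>g. g (prod_encode (j, i))) \<in> PiM (K j) (\<lambda>_. coin) \<rightarrow>\<^sub>M coin" for i
        by (rule measurable_component_singleton) (auto simp: K_def)
      then show "(\<lambda>g. g (prod_encode (j, i))) \<in> PiM (K j) (\<lambda>_. coin) \<rightarrow>\<^sub>M count_space UNIV" for i
        by (simp cong: measurable_cong_sets)
    qed
    show "disjoint_family_on K UNIV"
      by (auto simp: K_def disjoint_family_on_def)
  qed
  moreover have "trial A (restrict f (K j)) j = trial A f j" for f j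
    unfolding trial_def accepts_def by (simp add: K_def)
  ultimately show ?thesis by simp
qed

text \<open>Success at trial \<open>k\<close> with a given value has probability
  \<open>(1 - card A * p) ^ k * p\<close>; the geometric series bounds the probability of each value
  below by \<open>1 / card A\<close>. These bounds already add up to one, so they are equalities,
  and the default value \<open>Min A\<close> is accounted for as well.\<close>

lemma (in prob_space) prob_uniform_choice:
  assumes A: "finite A" "A \<noteq> {}" "a \<in> A"
    and ind: "indep_vars (\<lambda>_. coin) b UNIV"
    and fair: "\<And>i. distr M coin (b i) = coin"
  shows "prob {x \<in> space M. uniform_choice A (\<lambda>i. b i x) = a} = 1 / card A"
proof -
  define Y where "Y j x = trial A (\<lambda>i. b i x) j" for j x
  \<comment> \<open>Probability that the \<open>Suc (Max A)\<close> coins of one block show a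
    prescribed pattern.\<close>
  define p :: real where "p = (1/2) ^ Suc (Max A)"
  have b_meas: "b i \<in> M \<rightarrow>\<^sub>M coin" for i
    using ind by (auto simp: indep_vars_def)
  have b_meas' [measurable]: "b i \<in> M \<rightarrow>\<^sub>M count_space UNIV" for i
    using b_meas[of i] by (simp cong: measurable_cong_sets)
  have Y_meas [measurable]: "Y j \<in> M \<rightarrow>\<^sub>M count_space UNIV" for j
    unfolding Y_def by (intro measurable_trial A) simp
  have Y_ind: "indep_vars (\<lambda>_. count_space UNIV) Y UNIV"
    unfolding Y_def[abs_def] by (rule indep_vars_trial[OF A(1) ind])
  have U_meas [measurable]: "(\<lambda>x. uniform_choice A (\<lambda>i. b i x)) \<in> M \<rightarrow>\<^sub>M count_space UNIV"
    by (intro measurable_uniform_choice A) simp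
  have half: "prob (b i -` {c} \<inter> space M) = 1/2" for i c
  proof -
    have "prob (b i -` {c} \<inter> space M) = measure (distr M coin (b i)) {c}"
      by (rule measure_distr[symmetric, OF b_meas]) simp
    then show ?thesis by (cases c) (simp_all add: fair measure_pmf_single)
  qed
  have Some: "prob (Y j -` {Some c} \<inter> space M) = p" if "c \<in> A" for j c
  proof -
    \<comment> \<open>Indexing the intersection by the coins themselves lets
      \<open>indep_varsD\<close> apply; \<open>snd (prod_decode k)\<close> recovers the position of
      a coin in its block.\<close>
    have "Y j -` {Some c} \<inter> space M =
        (\<Inter>k\<in>(\<lambda>i. prod_encode (j, i)) ` {..Max A}. b k -` {snd (prod_decode k) = c} \<inter> space M)"
    proof -
      have "Y j x = Some c \<longleftrightarrow> (\<forall>i\<in>{..Max A}. b (prod_encode (j, i)) x = (i = c))" for x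
        using that by (simp add: Y_def trial_eq_Some_iff[OF A(1)] accepts_def Ball_def)
      then have "Y j -` {Some c} \<inter> space M =
          {x \<in> space M. \<forall>i\<in>{..Max A}. b (prod_encode (j, i)) x = (i = c)}"
        by blast
      also have "\<dots> =
          (\<Inter>k\<in>(\<lambda>i. prod_encode (j, i)) ` {..Max A}. b k -` {snd (prod_decode k) = c} \<inter> space M)"
        by auto
      finally show ?thesis .
    qed
    also have "prob \<dots> = (\<Prod>k\<in>(\<lambda>i. prod_encode (j, i)) ` {..Max A}. 1/2)"
      by (subst indep_varsD[OF ind]) (auto simp: half)
    also have "\<dots> = p"
      by (simp add: p_def card_image inj_on_def)
    finally show ?thesis .
  qed
  have None: "prob (Y j -` {None} \<inter> space M) = 1 - card A * p" for j
  proof -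
    have "space M - (Y j -` {None} \<inter> space M) = (\<Union>c\<in>A. Y j -` {Some c} \<inter> space M)"
      using trial_in[OF A(1)] by (auto simp: Y_def)
    moreover have "prob (\<Union>c\<in>A. Y j -` {Some c} \<inter> space M) = (\<Sum>c\<in>A. p)"
      by (subst finite_measure_finite_Union) (auto simp: A Some disjoint_family_on_def)
    ultimately show ?thesis using prob_compl[of "Y j -` {None} \<inter> space M"] by simp
  qed
  have p: "0 < p" "card A * p \<le> 1"
    using None[of 0] measure_nonneg[of M "Y 0 -` {None} \<inter> space M"] by (simp_all add: p_def)
  have U_event: "{x \<in> space M. uniform_choice A (\<lambda>i. b i x) = c} \<in> events" for c
    by measurable
  have cA: "0 < card A" using A by (simp add: card_gt_0_iff)
  have lower: "1 / card A \<le> prob {x \<in> space M. uniform_choice A (\<lambda>i. b i x) = c}" if c: "c \<in> A" for c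
  proof -
    \<comment> \<open>Splitting by the first successful trial makes the events disjoint and their
      probabilities a geometric sequence.\<close>
    define G where "G k = (\<Inter>j\<in>{..k}. Y j -` {if j = k then Some c else None} \<inter> space M)" for k
    have G: "prob (G k) = (1 - card A * p) ^ k * p" for k
    proof -
      have "prob (G k) = (\<Prod>j\<in>{..k}. prob (Y j -` {if j = k then Some c else None} \<inter> space M))"
        unfolding G_def by (rule indep_varsD[OF Y_ind]) auto
      also have "\<dots> = (\<Prod>j\<in>{..<Suc k}. if j = k then p else 1 - card A * p)"
        unfolding lessThan_Suc_atMost by (rule prod.cong) (auto simp: Some[OF c] None)
      also have "\<dots> = (1 - card A * p) ^ k * p" by simp
      finally show ?thesis .
    qed
    have disj: "disjoint_family G"
      unfolding disjoint_family_on_def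
    proof safe
      fix k l x assume "k \<noteq> l" "x \<in> G k" "x \<in> G l"
      then show "x \<in> {}"
        by (cases k l rule: linorder_cases) (force simp: G_def)+
    qed
    have Gs: "range G \<subseteq> events"
      by (auto simp: G_def)
    have "(\<lambda>k. prob (G k)) sums (1 / (1 - (1 - card A * p)) * p)"
      unfolding G by (intro sums_mult2 geometric_sums) (use p cA in auto)
    then have "prob (\<Union>k. G k) = 1 / card A"
      using sums_unique2[OF finite_measure_UNION[OF Gs disj]] p by simp
    moreover have "(\<Union>k. G k) \<subseteq> {x \<in> space M. uniform_choice A (\<lambda>i. b i x) = c}"
    proof safe
      fix k x assume x: "x \<in> G k"
      show "x \<in> space M" using x by (auto simp: G_def)
      have Y: "Y j x = (if j = k then Some c else None)" if "j \<le> k" for j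
        using x that unfolding G_def by (simp only: INT_iff Int_iff vimage_eq singleton_iff atMost_iff)
      show "uniform_choice A (\<lambda>i. b i x) = c"
        using Y by (intro uniform_choice_eqI[where k = k]) (auto simp: Y_def)
    qed
    ultimately show ?thesis
      by (metis (no_types, lifting) finite_measure_mono U_event)
  qed
  let ?P = "\<lambda>c. prob {x \<in> space M. uniform_choice A (\<lambda>i. b i x) = c}"
  have "(\<Sum>c\<in>A. ?P c) = prob (\<Union>c\<in>A. {x \<in> space M. uniform_choice A (\<lambda>i. b i x) = c})"
    by (rule finite_measure_finite_Union[symmetric]) (auto simp: A U_event disjoint_family_on_def)
  also have "\<dots> \<le> 1" by (rule prob_le_1)
  also have "1 = (\<Sum>c\<in>A. 1 / real (card A))" using cA by simp
  finally have total: "(\<Sum>c\<in>A. ?P c) \<le> (\<Sum>c\<in>A. 1 / real (card A))" .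
  show ?thesis
  proof (rule ccontr)
    assume "?P a \<noteq> 1 / card A"
    with lower[OF A(3)] have "1 / card A < ?P a" by simp
    then have "(\<Sum>c\<in>A. 1 / real (card A)) < (\<Sum>c\<in>A. ?P c)"
      by (intro sum_strict_mono_ex1 ballI lower A(1) bexI[OF _ A(3)]) 
    with total show False by simp
  qed
qed

section \<open>The law of the walks\<close>

definition next_vertex :: "nat set \<Rightarrow> (nat \<Rightarrow> bool) \<Rightarrow> nat \<Rightarrow> nat" where
  "next_vertex A coins j = uniform_choice A (\<lambda>i. coins (prod_encode (j, i)))"

lemma prob_space_coin_space: "prob_space coin_space"
  unfolding coin_space_def by (intro prob_space_PiM) (rule measure_pmf.prob_space_axioms)

interpretation coins: prob_space coin_space
  by (rule prob_space_coin_space)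

lemma space_coin_space [simp]: "space coin_space = UNIV"
  by (simp add: coin_space_def space_PiM)

lemma distr_coin: "distr coin_space coin (\<lambda>\<omega>. \<omega> k) = coin"
  unfolding coin_space_def
  by (rule distr_PiM_component) (auto intro: measure_pmf.prob_space_axioms)

lemma indep_coins: "coins.indep_vars (\<lambda>_. coin) (\<lambda>k \<omega>. \<omega> k) UNIV"
proof -
  have "(\<lambda>\<omega>. \<omega> k) \<in> coin_space \<rightarrow>\<^sub>M coin" for k :: "nat \<times> nat"
    unfolding coin_space_def by (rule measurable_component_singleton) simp
  then show ?thesis
    by (subst coins.indep_vars_iff_distr_eq_PiM)
       (simp_all add: distr_coin restrict_UNIV, simp add: coin_space_def)
qed

abbreviation site :: "(nat \<Rightarrow> nat \<Rightarrow> bool) \<Rightarrow> nat \<times> nat \<Rightarrow> (nat \<times> nat \<Rightarrow> bool) \<Rightarrow> nat" where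
  "site E k \<omega> \<equiv> next_vertex (nbrs E (fst k)) (\<lambda>i. \<omega> (fst k, i)) (snd k)"

text \<open>Different sites read disjoint sets of coins: the vertex selects the machine, and
  \<open>prod_encode\<close> gives each time its own stream of that machine's coins.\<close>

lemma indep_next_vertex:
  assumes "\<And>u. u \<in> V \<Longrightarrow> finite (nbrs E u)"
  shows "coins.indep_vars (\<lambda>_. count_space UNIV) (site E) (V \<times> UNIV)"
proof -
  define K where "K k = range (\<lambda>i. (fst k, prod_encode (snd k, i)))" for k :: "nat \<times> nat"
  have "coins.indep_vars (\<lambda>_. count_space UNIV) (\<lambda>k \<omega>. site E k (restrict \<omega> (K k))) (V \<times> UNIV)"
  proof (rule coins.indep_vars_disjoint_functions[OF indep_coins, where F = "site E"])
    show "site E k \<in> PiM (K k) (\<lambda>_. coin) \<rightarrow>\<^sub>M count_space UNIV" if "k \<in> V \<times> UNIV" for k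
      unfolding next_vertex_def
    proof (rule measurable_uniform_choice)
      have "(\<lambda>\<omega>. \<omega> (fst k, prod_encode (snd k, i))) \<in> PiM (K k) (\<lambda>_. coin) \<rightarrow>\<^sub>M coin" for i
        by (rule measurable_component_singleton) (auto simp: K_def)
      then show "(\<lambda>\<omega>. \<omega> (fst k, prod_encode (snd k, i))) \<in> PiM (K k) (\<lambda>_. coin) \<rightarrow>\<^sub>M count_space UNIV" for i
        by (simp cong: measurable_cong_sets)
    qed (use that assms in auto)
    show "disjoint_family_on K (V \<times> UNIV)"
      by (auto simp: K_def disjoint_family_on_def)
  qed
  moreover have "site E k (restrict \<omega> (K k)) = site E k \<omega>" for k \<omega>
    unfolding next_vertex_def by (simp add: K_def)
  ultimately show ?thesis by simp
qed

lemma prob_next_vertex: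
  assumes "finite (nbrs E u)" "nbrs E u \<noteq> {}"
  shows "coins.prob (site E (u, j) -` {a}) = pmf (pmf_of_set (nbrs E u)) a"
proof (cases "a \<in> nbrs E u")
  case True
  have "coins.indep_vars (\<lambda>_. coin) (\<lambda>i \<omega>. \<omega> (u, prod_encode (j, i))) UNIV"
    using coins.indep_vars_disjoint_functions[OF indep_coins,
        where K = "\<lambda>i. {(u, prod_encode (j, i))}" and F = "\<lambda>i g. g (u, prod_encode (j, i))"
          and R = coin and L = UNIV]
    by (simp add: disjoint_family_on_def)
  from coins.prob_uniform_choice[OF assms True this distr_coin]
  show ?thesis using assms True by (simp add: next_vertex_def vimage_def)
next
  case False
  then have "site E (u, j) -` {a} = {}"
    using uniform_choice_in[OF assms] by (auto simp: next_vertex_def)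
  with False assms show ?thesis by simp
qed

section \<open>Path probabilities of the simple random walk\<close>

lemma set_srw_pmf:
  assumes "\<And>u. u < n \<Longrightarrow> finite (nbrs E u) \<and> nbrs E u \<noteq> {} \<and> nbrs E u \<subseteq> {..<n}"
    and "v < n" "w \<in> set_pmf (srw_pmf E v k)"
  shows "length w = Suc k \<and> w ! 0 = v \<and> set w \<subseteq> {..<n}"
  using assms(3)
proof (induction k arbitrary: w)
  case 0
  then show ?case using assms(2) by simp
next
  case (Suc k)
  from Suc.prems obtain w' u where w': "w' \<in> set_pmf (srw_pmf E v k)"
    and u: "u \<in> set_pmf (pmf_of_set (nbrs E (last w')))" and w: "w = w' @ [u]"
    by auto
  note IH = Suc.IH[OF w']
  then have "w' \<noteq> []" by auto
  then have "last w' < n" using IH last_in_set[of w'] by blast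
  then have "u < n" using u assms(1)[of "last w'"] by (auto simp: set_pmf_of_set)
  then show ?case using IH by (auto simp: w nth_append)
qed

lemma pmf_srw:
  assumes "\<And>u. u < n \<Longrightarrow> finite (nbrs E u) \<and> nbrs E u \<noteq> {} \<and> nbrs E u \<subseteq> {..<n}"
    and "v < n" "length l = Suc k" "l ! 0 = v"
  shows "pmf (srw_pmf E v k) l = (\<Prod>i<k. pmf (pmf_of_set (nbrs E (l ! i))) (l ! Suc i))"
  using assms(3,4)
proof (induction k arbitrary: l)
  case 0
  then have "l = [v]" by (cases l) auto
  then show ?case by simp
next
  case (Suc k)
  define w u where "w = butlast l" "u = last l"
  have l: "l = w @ [u]" using Suc.prems by (simp add: w_u_def, metis append_butlast_last_id list.size(3) nat.distinct(1))
  have w: "length w = Suc k" "w ! 0 = v" using Suc.prems by (auto simp: l nth_append)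
  have inj: "inj (\<lambda>u. w @ [u])" by (auto simp: inj_on_def)
  \<comment> \<open>Only the prefix \<open>w\<close> can be extended to \<open>l\<close>, so the
    expectation over all prefixes collapses to one term.\<close>
  have "pmf (map_pmf (\<lambda>u. w' @ [u]) (pmf_of_set (nbrs E (last w')))) l =
      indicator {w} w' * pmf (pmf_of_set (nbrs E (last w))) u" for w'
  proof (cases "w' = w")
    case True
    then show ?thesis using pmf_map_inj'[OF inj] by (simp add: l)
  next
    case False
    then show ?thesis by (auto simp: l pmf_eq_0_set_pmf)
  qed
  then have "pmf (srw_pmf E v (Suc k)) l =
      measure_pmf.expectation (srw_pmf E v k) (\<lambda>w'. indicator {w} w' * pmf (pmf_of_set (nbrs E (last w))) u)"
    by (simp add: pmf_bind)
  also have "\<dots> = pmf (srw_pmf E v k) w * pmf (pmf_of_set (nbrs E (last w))) u"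
    by (simp add: pmf.rep_eq)
  also have "last w = w ! k" using w by (cases w) (auto simp: last_conv_nth)
  finally show ?case
    using w by (simp add: Suc.IH l nth_append)
qed

section \<open>The walks driven by shared steps\<close>

definition coupled_walk :: "(nat \<Rightarrow> nat \<Rightarrow> bool) \<Rightarrow> (nat \<times> nat \<Rightarrow> bool) \<Rightarrow> nat \<Rightarrow> nat \<Rightarrow> nat list" where
  "coupled_walk E \<omega> v T = map (\<lambda>k. travel (\<lambda>u j. site E (u, j) \<omega>) 0 k v) [0..<Suc T]"

text \<open>Fixing the target \<open>l\<close> replaces the random sites visited by sites known in
  advance, which turns the event into an intersection of independent ones.\<close>

lemma coupled_walk_eq_iff:
  assumes "length l = Suc T" "l ! 0 = v"
  shows "coupled_walk E \<omega> v T = l \<longleftrightarrow> (\<forall>i<T. site E (l ! i, i) \<omega> = l ! Suc i)"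
proof -
  let ?tr = "\<lambda>k. travel (\<lambda>u j. site E (u, j) \<omega>) 0 k v"
  have "coupled_walk E \<omega> v T = l \<longleftrightarrow> (\<forall>i\<le>T. ?tr i = l ! i)"
    using assms(1) by (auto simp: coupled_walk_def list_eq_iff_nth_eq less_Suc_eq_le simp del: upt_Suc)
  also have "\<dots> \<longleftrightarrow> (\<forall>i<T. site E (l ! i, i) \<omega> = l ! Suc i)"
  proof
    assume *: "\<forall>i\<le>T. ?tr i = l ! i"
    show "\<forall>i<T. site E (l ! i, i) \<omega> = l ! Suc i"
    proof (intro allI impI)
      fix i assume "i < T"
      then have "?tr i = l ! i" "?tr (Suc i) = l ! Suc i" using * by (simp_all del: travel.simps)
      then show "site E (l ! i, i) \<omega> = l ! Suc i" by simp
    qed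
  next
    assume *: "\<forall>i<T. site E (l ! i, i) \<omega> = l ! Suc i"
    have "i \<le> T \<Longrightarrow> ?tr i = l ! i" for i
      by (induction i) (use * assms in auto)
    then show "\<forall>i\<le>T. ?tr i = l ! i" by blast
  qed
  finally show ?thesis .
qed

text \<open>The two laws are compared on single lists. For a list of the right shape, independence
  gives the product of transition probabilities in \<open>pmf_srw\<close>; any other list has
  probability 0 on both sides.\<close>

lemma distr_coupled_walk:
  assumes nb: "\<And>u. u < n \<Longrightarrow> finite (nbrs E u) \<and> nbrs E u \<noteq> {} \<and> nbrs E u \<subseteq> {..<n}"
    and v: "v < n" and T: "1 \<le> T"
  shows "(\<lambda>\<omega>. coupled_walk E \<omega> v T) \<in> coin_space \<rightarrow>\<^sub>M count_space UNIV" (is "?W \<in> _")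
    and "distr coin_space (count_space UNIV) (\<lambda>\<omega>. coupled_walk E \<omega> v T) = measure_pmf (srw_pmf E v T)"
proof -
  note ind = indep_next_vertex[of "{..<n}" E]
  define good where "good l \<longleftrightarrow> length l = Suc T \<and> l ! 0 = v \<and> set l \<subseteq> {..<n}" for l :: "nat list"
  have site_less: "site E (u, j) \<omega> < n" if "u < n" for u j \<omega>
    using nb[OF that] uniform_choice_in[of "nbrs E u"] unfolding next_vertex_def by auto
  have W_good: "good (?W \<omega>)" for \<omega>
  proof -
    have "travel (\<lambda>u j. site E (u, j) \<omega>) 0 k v < n" for k
      by (rule travel_less[OF site_less v])
    then show ?thesis by (auto simp: good_def coupled_walk_def nth_append simp del: upt_Suc)
  qed
  have W_event: "?W -` {l} = (\<Inter>k\<in>(\<lambda>i. (l ! i, i)) ` {..<T}. site E k -` {l ! Suc (snd k)})"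
    if "good l" for l
    using that coupled_walk_eq_iff[of l T v E] by (auto simp: good_def)
  have site_event: "site E k -` {a} \<in> coins.events" if "fst k < n" for k a
  proof -
    have "site E k \<in> coin_space \<rightarrow>\<^sub>M count_space UNIV"
      using ind nb that by (auto simp: coins.indep_vars_def mem_Times_iff)
    from measurable_sets[OF this, of "{a}"] show ?thesis by simp
  qed
  \<comment> \<open>Both the product formula for independent events and the measurability of finite
    intersections ask for a nonempty index set.\<close>
  have ne: "{..<T} \<noteq> {}" using T by (metis empty_iff lessThan_iff less_le_trans zero_less_one)
  have mem: "l ! i < n" if "good l" "i < T" for l i
    using that nth_mem[of i l] unfolding good_def by (metis less_SucI lessThan_iff subsetD)
  have W_sets: "?W -` {l} \<in> coins.events" for l
  proof (cases "good l")
    case True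
    then show ?thesis
      unfolding W_event[OF True] using ne mem[OF True]
      by (intro sets.finite_INT site_event) auto
  next
    case False
    then have "?W -` {l} = {}" using W_good by auto
    then show ?thesis by simp
  qed
  show meas: "?W \<in> coin_space \<rightarrow>\<^sub>M count_space UNIV"
    by (subst measurable_count_space_eq_countable) (auto simp: W_sets)
  show "distr coin_space (count_space UNIV) ?W = measure_pmf (srw_pmf E v T)"
  proof (rule measure_eqI_countable[where A = UNIV])
    fix l :: "nat list"
    have "coins.prob (?W -` {l}) = pmf (srw_pmf E v T) l"
    proof (cases "good l")
      case True
      \<comment> \<open>The sites \<open>(l ! i, i)\<close> are distinct even if \<open>l\<close> revisits a vertex, because of the time index.\<close>
      have "coins.prob (?W -` {l}) =
          (\<Prod>k\<in>(\<lambda>i. (l ! i, i)) ` {..<T}. coins.prob (site E k -` {l ! Suc (snd k)}))"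
        unfolding W_event[OF True]
        using coins.indep_varsD[OF ind, of "(\<lambda>i. (l ! i, i)) ` {..<T}" "\<lambda>k. {l ! Suc (snd k)}"]
          nb ne mem[OF True] by auto
      also have "\<dots> = (\<Prod>i<T. coins.prob (site E (l ! i, i) -` {l ! Suc i}))"
        by (subst prod.reindex) (auto simp: inj_on_def)
      also have "\<dots> = (\<Prod>i<T. pmf (pmf_of_set (nbrs E (l ! i))) (l ! Suc i))"
        using nb mem[OF True] by (intro prod.cong prob_next_vertex) auto
      also have "\<dots> = pmf (srw_pmf E v T) l"
        using True by (intro pmf_srw[OF nb v, symmetric]) (auto simp: good_def)
      finally show ?thesis .
    next
      case False
      then have "?W -` {l} = {}" using W_good by auto
      moreover have "l \<notin> set_pmf (srw_pmf E v T)"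
        using False set_srw_pmf[OF nb v] unfolding good_def by blast
      ultimately show ?thesis by (simp add: pmf_eq_0_set_pmf)
    qed
    then show "emeasure (distr coin_space (count_space UNIV) ?W) {l} = emeasure (measure_pmf (srw_pmf E v T)) {l}"
      by (simp add: emeasure_distr[OF meas] coins.emeasure_eq_measure emeasure_pmf_single)
  qed auto
qed

text \<open>With \<open>2 <= n\<close> there is a second vertex, and a path to it starts with an
  edge at \<open>u\<close>.\<close>

lemma nbrs_connected:
  assumes "2 \<le> n" "simple_graph n E" "connected_graph n E" "u < n"
  shows "finite (nbrs E u) \<and> nbrs E u \<noteq> {} \<and> nbrs E u \<subseteq> {..<n}"
proof -
  have sub: "nbrs E u \<subseteq> {..<n}" using assms(2) by (auto simp: nbrs_def simple_graph_def)
  obtain w where "w < n" "w \<noteq> u"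
    using assms(1) by (metis One_nat_def Suc_1 less_le_trans lessI not_less_eq zero_less_Suc zero_neq_one)
  with assms(3,4) have "(u, w) \<in> {(x, y). E x y}\<^sup>*" by (auto simp: connected_graph_def)
  with \<open>w \<noteq> u\<close> have "nbrs E u \<noteq> {}"
    by (auto simp: nbrs_def elim: converse_rtranclE)
  with sub show ?thesis by (auto intro: finite_subset)
qed

section \<open>Round bounds\<close>

lemma log_ceil_le:
  assumes "1 \<le> tau"
  shows "real (log_ceil tau) \<le> log 2 (real tau) + 1"
proof (cases "log_ceil tau")
  case 0
  then show ?thesis using assms by simp
next
  case (Suc k)
  then have "\<not> tau \<le> 2 ^ k"
    unfolding log_ceil_def by (metis not_less_Least lessI)
  then have "log 2 (2 ^ k) \<le> log 2 (real tau)"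
    by (subst log_le_cancel_iff) (auto simp: numeral_power_le_of_nat_cancel_iff not_le)
  then show ?thesis using Suc by simp
qed

lemma pow2_ceil_le:
  assumes "1 \<le> tau"
  shows "pow2_ceil tau \<le> 2 * tau"
proof (cases "log_ceil tau")
  case 0
  then show ?thesis using assms by (simp add: pow2_ceil_def log_ceil_def)
next
  case (Suc k)
  then have "\<not> tau \<le> 2 ^ k"
    unfolding log_ceil_def by (metis not_less_Least lessI)
  then show ?thesis using Suc by (simp add: pow2_ceil_def log_ceil_def)
qed

abbreviation rounds_bound :: "nat \<Rightarrow> nat \<Rightarrow> nat" where
  "rounds_bound n tau \<equiv> 2 * log_ceil tau * batches n tau"

text \<open>The 2 in the constant comes from \<open>pow2_ceil tau <= 2 * tau\<close>, and
  \<open>1 / \<alpha>\<close> from absorbing the additive 1 of \<open>batches\<close> by the lower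
  bound on \<open>tau\<close>. The 4 comes from \<open>2 * (L + 1) <= 4 * L\<close> for
  \<open>L = log 2 tau\<close>, which is at least 1.\<close>

lemma rounds_long_walks:
  assumes "2 \<le> n" "2 \<le> tau" "0 < \<alpha>" "\<alpha> * real n / ln (real n) \<le> real tau"
  shows "real (rounds_bound n tau) \<le> (4 * (2 + 1 / \<alpha>)) * (real tau / real n) * log 2 (real tau) * log 2 (real n)"
proof -
  have ln0: "0 < ln (real n)" using assms by simp
  have ln_le: "ln (real n) \<le> log 2 (real n)"
    using ln0 ln_2_less_1 by (simp add: log_def field_simps mult_left_le)
  have log1: "1 \<le> log 2 (real n)" "1 \<le> log 2 (real tau)" using assms by (auto simp: le_log_iff)
  have "real (pow2_ceil tau div n) \<le> real (pow2_ceil tau) / real n"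
    by (rule of_nat_div_le_of_nat)
  also have "\<dots> \<le> 2 * (real tau / real n)"
    using pow2_ceil_le[of tau] assms by (simp add: field_simps)
  also have "\<dots> \<le> 2 * (real tau / real n) * log 2 (real n)"
    using mult_left_mono[of 1 "log 2 (real n)" "2 * (real tau / real n)"] log1 by simp
  finally have 1: "real (pow2_ceil tau div n) \<le> 2 * (real tau / real n) * log 2 (real n)" .
  have "1 \<le> 1 / \<alpha> * (real tau / real n) * ln (real n)"
    using assms ln0 by (simp add: field_simps)
  also have "\<dots> \<le> 1 / \<alpha> * (real tau / real n) * log 2 (real n)"
    using ln_le assms by (intro mult_left_mono) auto
  finally have "real (batches n tau) \<le> (2 + 1 / \<alpha>) * (real tau / real n) * log 2 (real n)"
    using 1 by (simp add: batches_def algebra_simps)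
  moreover have "real (2 * log_ceil tau) \<le> 4 * log 2 (real tau)"
    using log_ceil_le[of tau] assms(2) log1(2) by linarith
  ultimately have "real (2 * log_ceil tau) * real (batches n tau)
      \<le> (4 * log 2 (real tau)) * ((2 + 1 / \<alpha>) * (real tau / real n) * log 2 (real n))"
    using log1 by (intro mult_mono) auto
  then show ?thesis by (simp add: algebra_simps)
qed

text \<open>The walk length is at most \<open>2 * tau\<close>, hence below \<open>n\<close>, so each
  phase is a single batch of two rounds.\<close>

lemma rounds_short_walks:
  assumes "1 \<le> tau" "2 * tau < n"
  shows "real (rounds_bound n tau) \<le> 4 * max 1 (log 2 (real tau))"
proof -
  have "batches n tau = 1" using pow2_ceil_le[of tau] assms by (simp add: batches_def)
  then show ?thesis using log_ceil_le[OF assms(1)] by (simp add: max_def)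
qed

lemma eventually_le_div_ln:
  fixes K \<alpha> :: real
  assumes "0 < \<alpha>"
  shows "\<exists>N. \<forall>n\<ge>N. K \<le> \<alpha> * real n / ln (real n)"
proof -
  have "filterlim (\<lambda>n. \<alpha> * real n / ln (real n)) at_top sequentially"
    using assms by real_asymp
  then show ?thesis
    by (auto simp: filterlim_at_top eventually_sequentially)
qed

lemma eventually_div_ln_less:
  fixes \<alpha> :: real
  assumes "0 < \<alpha>"
  shows "\<exists>N. \<forall>n\<ge>N. 2 * \<alpha> * real n / ln (real n) < real n"
proof -
  have "eventually (\<lambda>n. 2 * \<alpha> * real n / ln (real n) < real n) sequentially"
    using assms by real_asymp
  then show ?thesis
    by (auto simp: eventually_sequentially)
qed

section \<open>Assembling algorithm, law and round bounds\<close>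

lemma walk_run_next_vertex:
  assumes "2 \<le> n" "simple_graph n E" "connected_graph n E"
  shows "walk_run next_vertex n E \<omega>"
proof
  show "next_vertex (nbrs E u) (\<lambda>i. \<omega> (u, i)) j < n" if "u < n" for u j
    using nbrs_connected[OF assms that] uniform_choice_in[of "nbrs E u"]
    unfolding next_vertex_def by auto
qed (use assms in simp)

text \<open>The round count is the same for all coins, so the event is the whole space and has
  probability one.\<close>

lemma prob_rounds_le:
  assumes "2 \<le> n" "simple_graph n E" "connected_graph n E" "real (rounds_bound n tau) \<le> R"
  shows "1 - real n powr (- c) \<le> measure coin_space
    {\<omega>. cc_terminates (walk_msg next_vertex) (walk_out next_vertex) n tau E \<omega> \<and>
         real (cc_rounds (walk_msg next_vertex) (walk_out next_vertex) n tau E \<omega>) \<le> R}"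
proof -
  note run = walk_run_next_vertex[OF assms(1-3)]
  show ?thesis
    using walk_run.terminates[OF run] walk_run.rounds[OF run] assms(4) coins.prob_space by simp
qed

theorem mainTheorem2:
  "\<forall>c::real. c > 0 \<longrightarrow>
    (\<exists>(msg :: msg_fn) (out :: out_fn) (B :: nat).
      \<comment> \<open>messages have O(log n) bits\<close>
      (\<forall>n tau E \<omega> t u w. 2 \<le> n \<and> 1 \<le> tau \<and> simple_graph n E \<and> connected_graph n E
          \<and> u < n \<and> w < n \<longrightarrow>
          length (cc_hist msg n tau E \<omega> (Suc t) t u w) \<le> B * nat \<lceil>log 2 (real n)\<rceil>)
    \<and> \<comment> \<open>correctness: each vertex ends with a walk distributed as a SRW of length tau'\<close>
      (\<forall>n tau E. 2 \<le> n \<and> 1 \<le> tau \<and> simple_graph n E \<and> connected_graph n E \<longrightarrow>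
          (AE \<omega> in coin_space. cc_terminates msg out n tau E \<omega>)
        \<and> (\<forall>v<n. cc_result msg out n tau E v \<in> coin_space \<rightarrow>\<^sub>M count_space UNIV
             \<and> distr coin_space (count_space UNIV) (cc_result msg out n tau E v)
                 = measure_pmf (srw_pmf E v (pow2_ceil tau))))
    \<and> \<comment> \<open>(i) tau = Omega(n / log n): O(tau/n log tau log n) rounds w.h.p.\<close>
      (\<forall>\<alpha>::real. \<alpha> > 0 \<longrightarrow> (\<exists>(C::real) (N::nat). \<forall>n tau E.
          N \<le> n \<and> 2 \<le> n \<and> 1 \<le> tau \<and> simple_graph n E \<and> connected_graph n E
          \<and> real tau \<ge> \<alpha> * real n / ln (real n) \<longrightarrow>
          measure coin_space {\<omega>. cc_terminates msg out n tau E \<omega> \<and>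
              real (cc_rounds msg out n tau E \<omega>)
                \<le> C * (real tau / real n) * log 2 (real tau) * log 2 (real n)}
            \<ge> 1 - real n powr (- c)))
    \<and> \<comment> \<open>(ii) tau = O(n / log n): O(log tau) rounds w.h.p.\<close>
      (\<forall>\<alpha>::real. \<alpha> > 0 \<longrightarrow> (\<exists>(C::real) (N::nat). \<forall>n tau E.
          N \<le> n \<and> 2 \<le> n \<and> 1 \<le> tau \<and> simple_graph n E \<and> connected_graph n E
          \<and> real tau \<le> \<alpha> * real n / ln (real n) \<longrightarrow>
          measure coin_space {\<omega>. cc_terminates msg out n tau E \<omega> \<and>
              real (cc_rounds msg out n tau E \<omega>) \<le> C * max 1 (log 2 (real tau))}
            \<ge> 1 - real n powr (- c))))"
\<comment> \<open>One algorithm serves every \<open>c\<close>. The witness 2 is the number of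
  vertices packed into a message of an even round.\<close>
proof (intro allI impI, rule exI[of _ "walk_msg next_vertex"], rule exI[of _ "walk_out next_vertex"],
    rule exI[of _ 2], intro conjI allI impI; (elim conjE)?)
  let ?msg = "walk_msg next_vertex" and ?out = "walk_out next_vertex"
  fix n tau t u w :: nat and E \<omega>
  assume "u < n" "w < n"
  then show "length (cc_hist ?msg n tau E \<omega> (Suc t) t u w) \<le> 2 * nat \<lceil>log 2 (real n)\<rceil>"
    using length_walk_msg by (simp add: word_size_def)
next
  let ?msg = "walk_msg next_vertex" and ?out = "walk_out next_vertex"
  fix n tau :: nat and E
  assume G: "2 \<le> n" "simple_graph n E" "connected_graph n E"
  then show "AE \<omega> in coin_space. cc_terminates ?msg ?out n tau E \<omega>"
    using walk_run.terminates[OF walk_run_next_vertex] by simp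
  fix v assume v: "v < n"
  have T: "1 \<le> pow2_ceil tau" by (simp add: pow2_ceil_def)
  have "cc_result ?msg ?out n tau E v = (\<lambda>\<omega>. coupled_walk E \<omega> v (pow2_ceil tau))"
    using walk_run.result[OF walk_run_next_vertex[OF G] v]
    by (simp add: fun_eq_iff walk_run.walk_def[OF walk_run_next_vertex[OF G]] coupled_walk_def
        walk_run.step_def[OF walk_run_next_vertex[OF G], abs_def] del: upt_Suc)
  with distr_coupled_walk[OF nbrs_connected[OF G] v T]
  show "cc_result ?msg ?out n tau E v \<in> coin_space \<rightarrow>\<^sub>M count_space UNIV"
    and "distr coin_space (count_space UNIV) (cc_result ?msg ?out n tau E v)
      = measure_pmf (srw_pmf E v (pow2_ceil tau))"
    by simp_all
next
  let ?msg = "walk_msg next_vertex" and ?out = "walk_out next_vertex"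
  fix c \<alpha> :: real assume \<alpha>: "0 < \<alpha>"
  \<comment> \<open>The value 2 forces \<open>2 <= tau\<close> for large \<open>n\<close>, as
    \<open>rounds_long_walks\<close> requires.\<close>
  from eventually_le_div_ln[OF this, of 2]
  obtain N where N: "\<And>n. N \<le> n \<Longrightarrow> 2 \<le> \<alpha> * real n / ln (real n)" by blast
  have "1 - real n powr (- c) \<le> measure coin_space {\<omega>. cc_terminates ?msg ?out n tau E \<omega> \<and>
      real (cc_rounds ?msg ?out n tau E \<omega>)
        \<le> (4 * (2 + 1 / \<alpha>)) * (real tau / real n) * log 2 (real tau) * log 2 (real n)}"
    if "N \<le> n \<and> 2 \<le> n \<and> 1 \<le> tau \<and> simple_graph n E \<and> connected_graph n E
        \<and> real tau \<ge> \<alpha> * real n / ln (real n)" for n tau E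
    using that N[of n] \<alpha> by (intro prob_rounds_le rounds_long_walks) auto
  then show "\<exists>(C::real) (N::nat). \<forall>n tau E.
        N \<le> n \<and> 2 \<le> n \<and> 1 \<le> tau \<and> simple_graph n E \<and> connected_graph n E
        \<and> real tau \<ge> \<alpha> * real n / ln (real n) \<longrightarrow>
        measure coin_space {\<omega>. cc_terminates ?msg ?out n tau E \<omega> \<and>
            real (cc_rounds ?msg ?out n tau E \<omega>)
              \<le> C * (real tau / real n) * log 2 (real tau) * log 2 (real n)}
          \<ge> 1 - real n powr (- c)" by blast
next
  let ?msg = "walk_msg next_vertex" and ?out = "walk_out next_vertex"
  fix c \<alpha> :: real assume \<alpha>: "0 < \<alpha>"
  from eventually_div_ln_less[OF this]
  obtain N where N: "\<And>n. N \<le> n \<Longrightarrow> 2 * \<alpha> * real n / ln (real n) < real n" by blast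
  have "1 - real n powr (- c) \<le> measure coin_space {\<omega>. cc_terminates ?msg ?out n tau E \<omega> \<and>
      real (cc_rounds ?msg ?out n tau E \<omega>) \<le> 4 * max 1 (log 2 (real tau))}"
    if "N \<le> n \<and> 2 \<le> n \<and> 1 \<le> tau \<and> simple_graph n E \<and> connected_graph n E
        \<and> real tau \<le> \<alpha> * real n / ln (real n)" for n tau E
    using that N[of n] by (intro prob_rounds_le rounds_short_walks) auto
  then show "\<exists>(C::real) (N::nat). \<forall>n tau E.
        N \<le> n \<and> 2 \<le> n \<and> 1 \<le> tau \<and> simple_graph n E \<and> connected_graph n E
        \<and> real tau \<le> \<alpha> * real n / ln (real n) \<longrightarrow>
        measure coin_space {\<omega>. cc_terminates ?msg ?out n tau E \<omega> \<and>
            real (cc_rounds ?msg ?out n tau E \<omega>) \<le> C * max 1 (log 2 (real tau))}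
          \<ge> 1 - real n powr (- c)" by blast
qed

end
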